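(* Let $g\ge 3$, $t\ge 1$ and $n$ be integers with $1\le t\le n-g$. For every graph $G\in\mathcal U_{n,g}^{(t)}$, $$\left\lceil\sqrt{n+\frac{t^2+4t}{4}}-\frac{t}{2}\right\rceil\le b(G)\le \lceil\sqrt{n}\rceil.$$
   Context: All graphs are finite and simple. Burning number: at time $0$ all vertices of $G$ are unburned. In each round $t\ge1$, one new unburned vertex is chosen to burn (if such a vertex exists), and every unburned neighbour of a vertex that was burned by the end of the previous round becomes burned; burned vertices stay burned. The process ends when all vertices are burned. $b(G)$ is the smallest $k$ such that $G$ can be completely burned within $k$ rounds by a suitable choice of vertices. For $a_1\ge a_2\ge\cdots\ge a_t\ge1$, $U_g^{a_1,\ldots,a_t}$ is the unicyclic graph obtained from a cycle $C_g=v_1v_2\cdots v_gv_1$ by attaching $t$ paths of lengths $a_1,\dots,a_t$ at the vertex $v_g$; that is, the $i$-th attached path contributes $a_i$ new vertices, one end of it being adjacent to $v_g$. Its order is $g+\sum_{i=1}^t a_i$. $\mathcal U_{n,g}^{(t)}$ denotes the set of all graphs $U_g^{a_1,\ldots,a_t}$ with $n=g+\sum_{i=1}^t a_i$. *)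

theory Defs
  imports Complex_Main
begin

record 'a ugraph =
  verts :: "'a set"
  edges :: "'a set set"

definition fin_simple_graph :: "'a ugraph \<Rightarrow> bool" where
  "fin_simple_graph G \<longleftrightarrow>
     finite (verts G) \<and> (\<forall>e\<in>edges G. e \<subseteq> verts G \<and> card e = 2)"

definition graph_iso :: "'a ugraph \<Rightarrow> 'b ugraph \<Rightarrow> bool" where
  "graph_iso G H \<longleftrightarrow>
     (\<exists>f. bij_betw f (verts G) (verts H) \<and>
          (\<forall>u\<in>verts G. \<forall>v\<in>verts G. {u, v} \<in> edges G \<longleftrightarrow> {f u, f v} \<in> edges H))"

definition nbrs :: "'a ugraph \<Rightarrow> 'a set \<Rightarrow> 'a set" where
  "nbrs G B = {v \<in> verts G. \<exists>u\<in>B. {u, v} \<in> edges G}"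

text \<open>One round leads from the burned set \<open>B\<close> to the burned set \<open>B'\<close>. The chosen vertex has to
  be unburned at the end of the previous round, and it starts spreading only in the next round.\<close>

definition burning_round :: "'a ugraph \<Rightarrow> 'a set \<Rightarrow> 'a set \<Rightarrow> bool" where
  "burning_round G B B' \<longleftrightarrow>
     (if verts G - B = {} then B' = B \<union> nbrs G B
      else (\<exists>x \<in> verts G - B. B' = insert x (B \<union> nbrs G B)))"

definition burnable_within :: "'a ugraph \<Rightarrow> nat \<Rightarrow> bool" where
  "burnable_within G k \<longleftrightarrow>
     (\<exists>B :: nat \<Rightarrow> 'a set. B 0 = {} \<and>
        (\<forall>r<k. burning_round G (B r) (B (Suc r))) \<and> B k = verts G)"

definition burning_number :: "'a ugraph \<Rightarrow> nat" where
  "burning_number G = (LEAST k. burnable_within G k)"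

text \<open>\<open>Cyc i\<close> is the cycle vertex \<open>v\<^sub>i\<close> for \<open>1 \<le> i \<le> g\<close>; \<open>Pth i j\<close> is the vertex at distance \<open>j\<close>
  from \<open>v\<^sub>g\<close> on the attached path number \<open>i\<close>, where the paths are numbered from \<open>0\<close>.\<close>

datatype uvert = Cyc nat | Pth nat nat

definition unicyclic :: "nat \<Rightarrow> nat list \<Rightarrow> uvert ugraph" where
  "unicyclic g as = \<lparr>
     verts = {Cyc i | i. 1 \<le> i \<and> i \<le> g}
           \<union> {Pth i j | i j. i < length as \<and> 1 \<le> j \<and> j \<le> as ! i},
     edges = {{Cyc i, Cyc (i + 1)} | i. 1 \<le> i \<and> i < g} \<union> {{Cyc g, Cyc 1}}
           \<union> {{Cyc g, Pth i 1} | i. i < length as}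
           \<union> {{Pth i j, Pth i (j + 1)} | i j. i < length as \<and> 1 \<le> j \<and> j < as ! i} \<rparr>"

text \<open>Graphs are taken up to isomorphism, so the vertices may be of an arbitrary type.\<close>

definition unicyclic_family :: "nat \<Rightarrow> nat \<Rightarrow> nat \<Rightarrow> 'a ugraph set" where
  "unicyclic_family n g t =
     {G. fin_simple_graph G \<and>
         (\<exists>as. length as = t \<and> sorted_wrt (\<ge>) as \<and> (\<forall>a\<in>set as. 1 \<le> a) \<and>
               n = g + sum_list as \<and> graph_iso G (unicyclic g as))}"

end

theory Submission
  imports Defs
begin

text \<open>
  Burning within \<open>k\<close> rounds is the same as covering the vertices by \<open>k\<close> balls of radii
  \<open>0, \<dots>, k - 1\<close>.  A ball of radius \<open>r\<close> on a path has at most \<open>2 * r + 1\<close> vertices, and these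
  numbers add up to \<open>k\<^sup>2\<close>; both bounds compare the graph with a path in this way.

  Upper bound.  Deleting a cycle edge at \<open>v\<^sub>g\<close> leaves a spanning spider, a tree whose legs all
  start at one head, and deleting edges does not make burning easier.  A spider with at most
  \<open>k\<^sup>2\<close> vertices can be covered (\<open>spider_cover\<close>), by induction on \<open>k\<close>.  If some leg has at
  least \<open>2 * k - 1\<close> vertices, the largest ball covers exactly \<open>2 * k - 1\<close> of them at the end of
  the leg.  Otherwise the largest ball is put at the head.  The leftover leg ends are then few and
  short enough for each to receive a smaller ball of its own, except when counting is tight: the
  spider has exactly \<open>k\<^sup>2\<close> vertices and \<open>k - j\<close> legs, all of length \<open>k - 1 + 2 * j\<close>.  Moving the
  largest ball one step onto a leg, which shortens one leftover and lengthens the others without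
  raising the radius that they need, settles this case.

  Lower bound.  A ball of radius \<open>r\<close> consists of at most \<open>2 * r + 1\<close> vertices along one line
  through its centre, together with side branches, which it reaches only through \<open>v\<^sub>g\<close>.
  Among the balls containing \<open>v\<^sub>g\<close>, the one that reaches farthest beyond it, say by \<open>\<rho>\<close>, already
  contains all side branches of the others.  It has itself only \<open>t\<close> side branches of \<open>\<rho>\<close>
  vertices each, and \<open>\<rho> \<le> k - 1\<close>.  Hence \<open>n \<le> k\<^sup>2 + t * (k - 1)\<close>
  (\<open>order_le_of_burnable_within_unicyclic\<close>), and completing the square gives the stated bound.
\<close>

section \<open>Burning and covering by balls\<close>

lemma burnable_within_iso:
  assumes "graph_iso G H" "burnable_within G k"
  shows "burnable_within H k"
proof -
  obtain f where f: "bij_betw f (verts G) (verts H) \<and>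
      (\<forall>u\<in>verts G. \<forall>v\<in>verts G. {u, v} \<in> edges G \<longleftrightarrow> {f u, f v} \<in> edges H)"
    using assms(1) unfolding graph_iso_def by (rule exE)
  note bij = f[THEN conjunct1] and adj = f[THEN conjunct2, rule_format]
  obtain B where B0: "B 0 = {}" and Bk: "B k = verts G"
    and step: "\<And>r. r < k \<Longrightarrow> burning_round G (B r) (B (Suc r))"
    using assms(2) unfolding burnable_within_def by blast
  have sub: "B r \<subseteq> verts G" if "r \<le> k" for r
    using that
  proof (induction r)
    case 0
    then show ?case using B0 by simp
  next
    case (Suc r)
    then show ?case
      using step[of r] by (auto simp: burning_round_def nbrs_def split: if_splits)
  qed
  have im: "f ` verts G = verts H" and inj: "inj_on f (verts G)"
    using bij unfolding bij_betw_def by blast+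
  have nb: "f ` nbrs G C = nbrs H (f ` C)" if C: "C \<subseteq> verts G" for C
  proof
    show "f ` nbrs G C \<subseteq> nbrs H (f ` C)"
    proof
      fix w assume "w \<in> f ` nbrs G C"
      then obtain u v where uv: "u \<in> C" "v \<in> verts G" "w = f v" "{u, v} \<in> edges G"
        unfolding nbrs_def by blast
      have "{f u, f v} \<in> edges H" using adj[THEN iffD1, OF _ uv(2,4)] uv(1) C by blast
      then show "w \<in> nbrs H (f ` C)" using uv im unfolding nbrs_def by blast
    qed
    show "nbrs H (f ` C) \<subseteq> f ` nbrs G C"
    proof
      fix w assume "w \<in> nbrs H (f ` C)"
      then obtain u v where uv: "u \<in> C" "v \<in> verts G" "w = f v" "{f u, f v} \<in> edges H"
        unfolding nbrs_def im[symmetric] by blast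
      have "{u, v} \<in> edges G" using adj[THEN iffD2, OF _ uv(2,4)] uv(1) C by blast
      then show "w \<in> f ` nbrs G C" using uv unfolding nbrs_def by blast
    qed
  qed
  have "burning_round H (f ` B r) (f ` B (Suc r))" if rk: "r < k" for r
  proof -
    have C: "B r \<subseteq> verts G" using sub rk by simp
    have diff: "f ` (verts G - B r) = verts H - f ` B r"
      using inj_on_image_set_diff[OF inj _ C, of "verts G"] by (simp only: im Diff_subset)
    show ?thesis
    proof (cases "verts G - B r = {}")
      case True
      then have "B (Suc r) = B r \<union> nbrs G (B r)"
        using step[OF rk] by (simp add: burning_round_def)
      moreover have "verts H - f ` B r = {}" unfolding diff[symmetric] True by simp
      ultimately show ?thesis
        by (simp add: burning_round_def image_Un nb[OF C])
    next
      case False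
      then obtain x where x: "x \<in> verts G - B r" "B (Suc r) = insert x (B r \<union> nbrs G (B r))"
        using step[OF rk] by (auto simp: burning_round_def)
      have "f x \<in> verts H - f ` B r" using x(1) diff by blast
      moreover have "f ` B (Suc r) = insert (f x) (f ` B r \<union> nbrs H (f ` B r))"
        by (simp only: x(2) image_insert image_Un nb[OF C])
      ultimately show ?thesis unfolding burning_round_def by (metis empty_iff)
    qed
  qed
  then show ?thesis
    unfolding burnable_within_def
    by (intro exI[of _ "\<lambda>r. f ` B r"] conjI allI impI) (simp_all only: B0 Bk im image_empty)
qed

lemma graph_iso_sym:
  assumes "graph_iso G H"
  shows "graph_iso H G"
proof -
  obtain f where f: "bij_betw f (verts G) (verts H) \<and>
      (\<forall>u\<in>verts G. \<forall>v\<in>verts G. {u, v} \<in> edges G \<longleftrightarrow> {f u, f v} \<in> edges H)"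
    using assms unfolding graph_iso_def by (rule exE)
  note bij = f[THEN conjunct1] and adj = f[THEN conjunct2, rule_format]
  let ?h = "inv_into (verts G) f"
  have "{u, v} \<in> edges H \<longleftrightarrow> {?h u, ?h v} \<in> edges G" if "u \<in> verts H" "v \<in> verts H" for u v
  proof -
    have "?h w \<in> verts G" "f (?h w) = w" if "w \<in> verts H" for w
      using that bij bij_betw_inv_into_right[OF bij] inv_into_into[of w f "verts G"]
      by (auto simp: bij_betw_def)
    then show ?thesis using adj[of "?h u" "?h v"] that by simp
  qed
  then show ?thesis
    unfolding graph_iso_def using bij_betw_inv_into[OF bij] by (intro exI[of _ ?h]) simp
qed

definition burn_spread :: "'a ugraph \<Rightarrow> 'a set \<Rightarrow> 'a set" where
  "burn_spread G B = B \<union> nbrs G B"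

definition graph_ball :: "'a ugraph \<Rightarrow> 'a \<Rightarrow> nat \<Rightarrow> 'a set" where
  "graph_ball G x r = (burn_spread G ^^ r) {x}"

lemma burn_spread_mono: "B \<subseteq> C \<Longrightarrow> burn_spread G B \<subseteq> burn_spread G C"
  by (auto simp: burn_spread_def nbrs_def)

lemma burn_spread_funpow_mono:
  "B \<subseteq> C \<Longrightarrow> (burn_spread G ^^ r) B \<subseteq> (burn_spread G ^^ r) C"
  by (induction r) (auto dest: burn_spread_mono)

lemma graph_ball_radius_mono:
  assumes "r \<le> s"
  shows "graph_ball G x r \<subseteq> graph_ball G x s"
  using assms
proof (induction s rule: dec_induct)
  case (step s)
  have "graph_ball G x s \<subseteq> graph_ball G x (Suc s)"
    by (auto simp: graph_ball_def burn_spread_def)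
  with step.IH show ?case by blast
qed simp

lemma graph_ball_trans:
  assumes "y \<in> graph_ball G x r" "z \<in> graph_ball G y s"
  shows "z \<in> graph_ball G x (r + s)"
proof -
  have "(burn_spread G ^^ s) {y} \<subseteq> (burn_spread G ^^ s) (graph_ball G x r)"
    using assms(1) by (intro burn_spread_funpow_mono) auto
  also have "\<dots> = graph_ball G x (s + r)"
    by (simp add: graph_ball_def funpow_add)
  finally show ?thesis using assms(2) by (auto simp: graph_ball_def add.commute)
qed

lemma graph_ball_edge:
  assumes "{x, y} \<in> edges G" "y \<in> verts G"
  shows "y \<in> graph_ball G x 1"
  using assms by (auto simp: graph_ball_def burn_spread_def nbrs_def)

text \<open>The balls may overlap, and their centres may burn before their turn: a round whose
  prescribed source is already on fire is spent on an arbitrary unburned vertex, which cannot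
  hurt.  The ball of radius \<open>r\<close> is lit in round \<open>k - r\<close>, so it has \<open>r\<close> rounds left to spread.\<close>

lemma burnable_within_of_ball_cover:
  assumes centre: "\<And>r. r < k \<Longrightarrow> c r \<in> verts G"
    and cover: "\<And>v. v \<in> verts G \<Longrightarrow> \<exists>r<k. v \<in> graph_ball G (c r) r"
  shows "burnable_within G k"
proof -
  define pick where "pick s C = (if c (k - 1 - s) \<in> C then SOME x. x \<in> verts G - C
    else c (k - 1 - s))" for s C
  define B where "B = rec_nat {} (\<lambda>s C. if verts G - C = {} then burn_spread G C
    else insert (pick s C) (burn_spread G C))"
  have B0: "B 0 = {}"
    and BS: "\<And>s. B (Suc s) = (if verts G - B s = {} then burn_spread G (B s)
      else insert (pick s (B s)) (burn_spread G (B s)))"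
    by (auto simp: B_def)
  have pick: "pick s (B s) \<in> verts G - B s" if "s < k" "verts G - B s \<noteq> {}" for s
    using that centre[of "k - 1 - s"] some_in_eq[of "verts G - B s"]
    unfolding pick_def by auto
  have sub: "B s \<subseteq> verts G" if "s \<le> k" for s
    using that
  proof (induction s)
    case (Suc s)
    then show ?case
      using pick[of s] by (auto simp: BS burn_spread_def nbrs_def)
  qed (simp add: B0)
  have round: "burning_round G (B s) (B (Suc s))" if "s < k" for s
    using pick[OF that] unfolding burning_round_def BS burn_spread_def by auto
  have grow: "burn_spread G (B s) \<subseteq> B (Suc s)" for s
    by (auto simp: BS)
  have grow': "(burn_spread G ^^ j) (B s) \<subseteq> B (s + j)" for s j
  proof (induction j)
    case (Suc j)
    then show ?case
      using burn_spread_mono[OF Suc] grow[of "s + j"] by auto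
  qed simp
  have lit: "c (k - 1 - s) \<in> B (Suc s)" if "s < k" for s
    using that centre[of "k - 1 - s"] by (auto simp: BS burn_spread_def pick_def)
  have "verts G \<subseteq> B k"
  proof
    fix v assume "v \<in> verts G"
    then obtain r where r: "r < k" "v \<in> graph_ball G (c r) r" using cover by blast
    have "c r \<in> B (k - r)"
      using lit[of "k - 1 - r"] r(1) by (simp add: Suc_diff_Suc)
    then have "graph_ball G (c r) r \<subseteq> (burn_spread G ^^ r) (B (k - r))"
      unfolding graph_ball_def by (intro burn_spread_funpow_mono) auto
    also have "\<dots> \<subseteq> B k" using grow'[of r "k - r"] r(1) by simp
    finally show "v \<in> B k" using r(2) by blast
  qed
  then show ?thesis
    using sub[of k] B0 round unfolding burnable_within_def by (intro exI[of _ B]) auto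
qed

text \<open>Conversely, a burning sequence covers the graph by balls with respect to any function that
  bounds the graph distance from below, that is, grows by at most one along each edge.\<close>

lemma ball_cover_of_burnable_within:
  fixes d :: "'a \<Rightarrow> 'a \<Rightarrow> int"
  assumes burn: "burnable_within G k" and v0: "v0 \<in> verts G"
    and refl: "\<And>x. x \<in> verts G \<Longrightarrow> d x x = 0"
    and lip: "\<And>x u v. x \<in> verts G \<Longrightarrow> u \<in> verts G \<Longrightarrow> v \<in> verts G \<Longrightarrow> {u, v} \<in> edges G
      \<Longrightarrow> d x v \<le> d x u + 1"
  shows "\<exists>c. (\<forall>r. c r \<in> verts G) \<and> (\<forall>v\<in>verts G. \<exists>r<k. d (c r) v \<le> int r)"
proof -
  obtain B where B0: "B 0 = {}" and Bk: "B k = verts G"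
    and step: "\<And>r. r < k \<Longrightarrow> burning_round G (B r) (B (Suc r))"
    using burn unfolding burnable_within_def by blast
  have "\<exists>x. x \<in> verts G \<and> B (Suc s) \<subseteq> insert x (B s \<union> nbrs G (B s))" if "s < k" for s
    using step[OF that] v0 unfolding burning_round_def by (auto split: if_splits)
  then have "\<exists>x. x \<in> verts G \<and> (s < k \<longrightarrow> B (Suc s) \<subseteq> insert x (B s \<union> nbrs G (B s)))" for s
    using v0 by blast
  then obtain x where xV: "\<And>s. x s \<in> verts G"
    and xB: "\<And>s. s < k \<Longrightarrow> B (Suc s) \<subseteq> insert (x s) (B s \<union> nbrs G (B s))"
    by metis
  have inv: "B s \<subseteq> verts G \<and> (\<forall>v\<in>B s. \<exists>q<s. d (x q) v \<le> int s - 1 - int q)" if "s \<le> k" for s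
    using that
  proof (induction s)
    case (Suc s)
    then have IH: "B s \<subseteq> verts G" "\<And>v. v \<in> B s \<Longrightarrow> \<exists>q<s. d (x q) v \<le> int s - 1 - int q"
      by auto
    have new: "B (Suc s) \<subseteq> insert (x s) (B s \<union> nbrs G (B s))" using xB Suc.prems by simp
    show ?case
    proof (intro conjI ballI)
      show "B (Suc s) \<subseteq> verts G" using new IH(1) xV[of s] by (auto simp: nbrs_def)
    next
      fix v assume "v \<in> B (Suc s)"
      then consider "v = x s" | "v \<in> B s" | u where "u \<in> B s" "v \<in> verts G" "{u, v} \<in> edges G"
        using new by (auto simp: nbrs_def)
      then show "\<exists>q<Suc s. d (x q) v \<le> int (Suc s) - 1 - int q"
      proof cases
        case 1
        then show ?thesis using refl[OF xV[of s]] by (intro exI[of _ s]) auto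
      next
        case 2
        then obtain q where "q < s" "d (x q) v \<le> int s - 1 - int q" using IH(2) by blast
        then show ?thesis by (intro exI[of _ q]) auto
      next
        case 3
        then obtain q where "q < s" "d (x q) u \<le> int s - 1 - int q" using IH(2) by blast
        then show ?thesis
          using lip[OF xV[of q] _ 3(2,3)] 3(1) IH(1) by (intro exI[of _ q]) force
      qed
    qed
  qed (simp add: B0)
  show ?thesis
  proof (intro exI[of _ "\<lambda>r. x (k - 1 - r)"] conjI allI ballI)
    show "x (k - 1 - r) \<in> verts G" for r by (rule xV)
  next
    fix v assume "v \<in> verts G"
    then obtain q where "q < k" "d (x q) v \<le> int k - 1 - int q" using inv[of k] Bk by auto
    then show "\<exists>r<k. d (x (k - 1 - r)) v \<le> int r"
      by (intro exI[of _ "k - 1 - q"]) (auto simp: of_nat_diff)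
  qed
qed

section \<open>Spiders\<close>

text \<open>The points of a spider are pairs \<open>(i, j)\<close>, the vertex on leg \<open>i\<close> at distance \<open>j\<close> from the
  head; the head is represented by every pair \<open>(i, 0)\<close>.\<close>

fun spider_dist :: "'i \<times> nat \<Rightarrow> 'i \<times> nat \<Rightarrow> nat" where
  "spider_dist (i, j) (i', j') = (if i = i' then (j - j') + (j' - j) else j + j')"

text \<open>This is Hall's condition for demands that are upward closed: serve the largest demand with
  the largest resource.\<close>

lemma threshold_assignment:
  fixes f :: "'i \<Rightarrow> nat"
  assumes "finite I" and "\<And>j. card {i \<in> I. j \<le> f i} \<le> K - j"
  shows "\<exists>\<sigma>. inj_on \<sigma> I \<and> (\<forall>i\<in>I. f i \<le> \<sigma> i \<and> \<sigma> i < K)"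
  using assms
proof (induction K arbitrary: I)
  case 0
  from 0(2)[of 0] 0(1) show ?case by simp
next
  case (Suc K)
  show ?case
  proof (cases "I = {}")
    case False
    define m where "m = Max (f ` I)"
    have "m \<in> f ` I" unfolding m_def using Suc.prems(1) False by (intro Max_in) auto
    then obtain i0 where i0: "i0 \<in> I" "f i0 = m" by auto
    have max: "f i \<le> m" if "i \<in> I" for i
      unfolding m_def using Suc.prems(1) that by (intro Max_ge) auto
    have "card {i \<in> I. Suc K \<le> f i} = 0" using Suc.prems(2)[of "Suc K"] by simp
    then have mK: "m \<le> K" using Suc.prems(1) i0 by (auto simp: not_less_eq_eq)
    have "card {i \<in> I - {i0}. j \<le> f i} \<le> K - j" for j
    proof (cases "j \<le> m")
      case True
      have "{i \<in> I - {i0}. j \<le> f i} = {i \<in> I. j \<le> f i} - {i0}" by auto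
      then have "card {i \<in> I - {i0}. j \<le> f i} = card {i \<in> I. j \<le> f i} - 1"
        using Suc.prems(1) i0 True by (simp add: card_Diff_singleton)
      then show ?thesis using Suc.prems(2)[of j] by linarith
    next
      case j: False
      have none: "{i \<in> I - {i0}. j \<le> f i} = {}" using max j by (auto dest!: max)
      show ?thesis unfolding none by simp
    qed
    then obtain \<sigma> where \<sigma>: "inj_on \<sigma> (I - {i0})" "\<forall>i\<in>I - {i0}. f i \<le> \<sigma> i \<and> \<sigma> i < K"
      using Suc.IH[of "I - {i0}"] Suc.prems(1) by blast
    have "inj_on (\<sigma>(i0 := K)) I"
      using \<sigma> by (auto simp: inj_on_def)
    moreover have "\<forall>i\<in>I. f i \<le> (\<sigma>(i0 := K)) i \<and> (\<sigma>(i0 := K)) i < Suc K"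
      using \<sigma>(2) i0 mK by (auto simp: less_Suc_eq)
    ultimately show ?thesis by blast
  qed simp
qed

text \<open>One ball of radius \<open>K\<close> around a point \<open>(i0, d)\<close> near the head burns the beginning of every
  leg; each remaining leg end is then a path, for which one ball of its own has to be found among
  the radii below \<open>K\<close>.  A path of \<open>m\<close> vertices needs radius at least \<open>m div 2\<close>.\<close>

lemma spider_cover_of_head_ball:
  fixes a :: "'i \<Rightarrow> nat" and d K :: nat
  defines "reached \<equiv> \<lambda>i i0. if i = i0 then K + d else K - d"
  assumes fin: "finite I" and i0: "i0 \<in> I" "d \<le> a i0" "d \<le> K"
    and hall: "\<And>j. card {i \<in> I. reached i i0 < a i \<and> j \<le> (a i - reached i i0) div 2} \<le> K - j"
  shows "\<exists>c. (\<forall>r<Suc K. fst (c r) \<in> I \<and> snd (c r) \<le> a (fst (c r))) \<and>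
    (\<forall>i\<in>I. \<forall>j\<le>a i. \<exists>r<Suc K. spider_dist (c r) (i, j) \<le> r)"
proof -
  define J where "J = {i \<in> I. reached i i0 < a i}"
  have finJ: "finite J" using fin by (simp add: J_def)
  have "card {i \<in> J. j \<le> (a i - reached i i0) div 2} \<le> K - j" for j
    using hall[of j] by (simp add: J_def conj_assoc)
  from threshold_assignment[OF finJ this]
  obtain \<sigma> where \<sigma>: "inj_on \<sigma> J"
    "\<And>i. i \<in> J \<Longrightarrow> (a i - reached i i0) div 2 \<le> \<sigma> i \<and> \<sigma> i < K"
    by auto
  define c where "c r = (if r \<in> \<sigma> ` J then (inv_into J \<sigma> r, a (inv_into J \<sigma> r) - r) else (i0, d))" for r
  have cJ: "c (\<sigma> i) = (i, a i - \<sigma> i)" if "i \<in> J" for i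
    using that \<sigma>(1) by (simp add: c_def)
  have cK: "c K = (i0, d)" using \<sigma>(2) by (force simp: c_def)
  show ?thesis
  proof (intro exI[of _ c] conjI allI impI ballI)
    fix r
    show "fst (c r) \<in> I" "snd (c r) \<le> a (fst (c r))"
      using i0 inv_into_into[of r \<sigma> J] by (auto simp: c_def J_def)
  next
    fix i j assume ij: "i \<in> I" "j \<le> a i"
    show "\<exists>r<Suc K. spider_dist (c r) (i, j) \<le> r"
    proof (cases "j \<le> reached i i0")
      case True
      then have "spider_dist (c K) (i, j) \<le> K"
        using i0(3) by (auto simp: cK reached_def split: if_splits)
      then show ?thesis by blast
    next
      case False
      then have iJ: "i \<in> J" using ij by (simp add: J_def)
      have "a i - reached i i0 \<le> 2 * \<sigma> i + 1" using \<sigma>(2)[OF iJ] by linarith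
      then have "spider_dist (c (\<sigma> i)) (i, j) \<le> \<sigma> i"
        using False ij by (simp add: cJ[OF iJ])
      then show ?thesis using \<sigma>(2)[OF iJ] by (meson less_SucI)
    qed
  qed
qed

text \<open>With \<open>k = K + 1\<close> and no long leg, put the largest ball at the head.  If Hall's condition
  fails at \<open>j\<close>, then \<open>1 \<le> j\<close> and \<open>2 * j \<le> K\<close>, and at least \<open>K + 1 - j\<close> legs have length at least
  \<open>K + 2 * j\<close>.  These alone contain at least
  \<open>(K + 1 - j) * (K + 2 * j) = K\<^sup>2 + 2 * K + (j - 1) * (K - 2 * j)\<close> vertices, which is no less than
  the number available outside the head, so equality holds throughout and the spider is known
  completely.  For it, the ball is moved to distance \<open>1\<close> from the head.\<close>

lemma spider_cover:
  fixes a :: "'i \<Rightarrow> nat"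
  assumes "finite I" "I \<noteq> {}" "1 + sum a I \<le> k\<^sup>2"
  shows "\<exists>c. (\<forall>r<k. fst (c r) \<in> I \<and> snd (c r) \<le> a (fst (c r))) \<and>
    (\<forall>i\<in>I. \<forall>j\<le>a i. \<exists>r<k. spider_dist (c r) (i, j) \<le> r)"
  using assms
proof (induction k arbitrary: a)
  case 0
  then show ?case by simp
next
  case (Suc K)
  note fin = Suc.prems(1)
  have total: "sum a I \<le> K\<^sup>2 + 2 * K"
    using Suc.prems(3) by (simp add: power2_eq_square)
  show ?case
  proof (cases "\<exists>i\<in>I. 2 * K + 1 \<le> a i")
    case True
    then obtain i0 where i0: "i0 \<in> I" "2 * K + 1 \<le> a i0" by blast
    \<comment> \<open>The ball of radius \<open>K\<close> takes the last \<open>2 * K + 1\<close> vertices of this leg.\<close>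
    define a' where "a' = a(i0 := a i0 - (2 * K + 1))"
    have "sum a' I = a' i0 + sum a' (I - {i0})" using fin i0 by (simp add: sum.remove)
    also have "sum a' (I - {i0}) = sum a (I - {i0})" by (rule sum.cong) (auto simp: a'_def)
    finally have "sum a' I + (2 * K + 1) = sum a I"
      using i0 sum.remove[OF fin i0(1), of a] by (simp add: a'_def)
    then have "1 + sum a' I \<le> K\<^sup>2" using total by linarith
    then obtain c where c: "\<forall>r<K. fst (c r) \<in> I \<and> snd (c r) \<le> a' (fst (c r))"
      "\<forall>i\<in>I. \<forall>j\<le>a' i. \<exists>r<K. spider_dist (c r) (i, j) \<le> r"
      using Suc.IH[OF fin Suc.prems(2)] by blast
    have le: "a' i \<le> a i" for i by (simp add: a'_def)
    define c' where "c' = c(K := (i0, a i0 - K))"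
    show ?thesis
    proof (intro exI[of _ c'] conjI allI impI ballI)
      fix r assume "r < Suc K"
      then show "fst (c' r) \<in> I" "snd (c' r) \<le> a (fst (c' r))"
        using c(1) i0 le order_trans by (fastforce simp: c'_def less_Suc_eq)+
    next
      fix i j assume ij: "i \<in> I" "j \<le> a i"
      show "\<exists>r<Suc K. spider_dist (c' r) (i, j) \<le> r"
      proof (cases "j \<le> a' i")
        case True
        then obtain r where "r < K" "spider_dist (c r) (i, j) \<le> r" using c(2) ij by blast
        then show ?thesis by (intro exI[of _ r]) (auto simp: c'_def)
      next
        case False
        then have "i = i0" using ij by (auto simp: a'_def split: if_splits)
        then have "spider_dist (c' K) (i, j) \<le> K"
          using False ij by (auto simp: c'_def a'_def)
        then show ?thesis by blast
      qed
    qed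
  next
    case False
    then have short: "a i \<le> 2 * K" if "i \<in> I" for i using that by force
    define N where "N j = {i \<in> I. K < a i \<and> j \<le> (a i - K) div 2}" for j
    show ?thesis
    proof (cases "\<forall>j. card (N j) \<le> K - j")
      case True
      obtain i0 where "i0 \<in> I" using Suc.prems(2) by blast
      moreover have "card {i \<in> I. (if i = i0 then K + 0 else K - 0) < a i \<and>
          j \<le> (a i - (if i = i0 then K + 0 else K - 0)) div 2} \<le> K - j" for j
        using True unfolding N_def add_0_right diff_zero if_cancel by blast
      ultimately show ?thesis
        by (intro spider_cover_of_head_ball[of I i0 0 a K] fin) simp_all
    next
      case False
      then obtain j where j: "K - j < card (N j)" by (meson not_le)
      define S where "S = N j"
      have S: "S \<subseteq> I" "finite S" using fin by (auto simp: S_def N_def)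
      have big: "K + 2 * j \<le> a i" "K + 1 \<le> a i" if "i \<in> S" for i
        using that by (auto simp: S_def N_def)
      have split: "sum a I = sum a S + sum a (I - S)"
        using sum.subset_diff[OF S(1) fin, of a] by simp
      have "S \<noteq> {}" using j by (auto simp: S_def)
      then obtain i0 where i0: "i0 \<in> S" by blast
      have jK: "2 * j \<le> K" using big(1)[OF i0] short[of i0] S i0 by auto
      have j1: "1 \<le> j"
      proof (rule ccontr)
        assume "\<not> 1 \<le> j"
        then have "K + 1 \<le> card S" using j by (simp add: S_def)
        then have "(K + 1) * (K + 1) \<le> card S * (K + 1)" by (intro mult_right_mono) auto
        also have "\<dots> \<le> sum a S" using sum_bounded_below[of S "K + 1" a] big(2) by simp
        also have "\<dots> \<le> K\<^sup>2 + 2 * K" using split total by linarith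
        finally show False by (simp add: power2_eq_square)
      qed
      have card: "K + 1 - j \<le> card S" using j jK by (simp add: S_def)
      have excess: "sum a S = sum (\<lambda>i. a i - (K + 2 * j)) S + card S * (K + 2 * j)"
      proof -
        have "sum a S = sum (\<lambda>i. (a i - (K + 2 * j)) + (K + 2 * j)) S"
          using big(1) by (intro sum.cong) auto
        then show ?thesis by (simp add: sum.distrib)
      qed
      \<comment> \<open>The difference of the two sides is \<open>(j - 1) * (K - 2 * j)\<close>; the substitutions make both
        factors natural numbers.\<close>
      have crit: "K\<^sup>2 + 2 * K \<le> (K + 1 - j) * (K + 2 * j)"
      proof -
        obtain p where p: "j = Suc p" using j1 by (cases j) auto
        obtain q where q: "K = 2 * j + q" using jK le_Suc_ex by blast
        show ?thesis unfolding q p by (simp add: power2_eq_square algebra_simps)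
      qed
      have low: "(K + 1 - j) * (K + 2 * j) \<le> card S * (K + 2 * j)"
        using card by (intro mult_right_mono) auto
      have "sum a (I - S) = 0" "sum (\<lambda>i. a i - (K + 2 * j)) S = 0"
        "card S * (K + 2 * j) = (K + 1 - j) * (K + 2 * j)"
        using split excess total crit low by linarith+
      then have off: "\<And>i. i \<in> I - S \<Longrightarrow> a i = 0" and on: "\<And>i. i \<in> S \<Longrightarrow> a i = K + 2 * j"
        and cardS: "card S = K + 1 - j"
        using fin S big(1) j1 by (auto simp: sum_eq_0_iff le_antisym)
      define reached where "reached i = (if i = i0 then K + 1 else K - 1)" for i
      have "card {i \<in> I. reached i < a i \<and> j' \<le> (a i - reached i) div 2} \<le> K - j'" for j'
      proof -
        define T where "T = {i \<in> I. reached i < a i \<and> j' \<le> (a i - reached i) div 2}"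
        have TS: "T \<subseteq> S" using off by (force simp: T_def)
        \<comment> \<open>The leftovers have \<open>2 * j - 1\<close> vertices on the leg \<open>i0\<close> and \<open>2 * j + 1\<close> on the others;
          only the former gets a smaller radius, but one such gain is all that Hall's condition
          lacks.\<close>
        have val: "(a i - reached i) div 2 = (if i = i0 then j - 1 else j)" if "i \<in> S" for i
          using on[OF that] j1 jK by (auto simp: reached_def)
        consider "j' < j" | "j' = j" | "j < j'" by linarith
        then have "card T \<le> K - j'"
        proof cases
          case 1
          then show ?thesis using card_mono[OF S(2) TS] cardS by linarith
        next
          case 2
          then have "T \<subseteq> S - {i0}" using TS val[OF i0] j1 by (auto simp: T_def)
          then have "card T \<le> card (S - {i0})" using S(2) by (intro card_mono) auto
          then show ?thesis using cardS i0 S(2) 2 by simp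
        next
          case 3
          have "T = {}"
          proof (rule ccontr)
            assume "T \<noteq> {}"
            then obtain i where "i \<in> T" by blast
            then show False using val[of i] TS 3 by (auto simp: T_def split: if_splits)
          qed
          then show ?thesis by simp
        qed
        then show ?thesis by (simp add: T_def)
      qed
      then show ?thesis
        unfolding reached_def using fin i0 S(1) on[OF i0] j1 jK
        by (intro spider_cover_of_head_ball[of I i0 1 a K]) auto
    qed
  qed
qed

lemma leg_point_in_graph_ball:
  assumes vert: "\<And>j. j \<le> m \<Longrightarrow> p j \<in> verts G"
    and edge: "\<And>j. j < m \<Longrightarrow> {p j, p (Suc j)} \<in> edges G"
    and "s \<le> m" "s' \<le> m"
  shows "p s' \<in> graph_ball G (p s) ((s - s') + (s' - s))"
proof -
  have up: "p (s + e) \<in> graph_ball G (p s) e \<and> p s \<in> graph_ball G (p (s + e)) e"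
    if "s + e \<le> m" for s e
    using that
  proof (induction e)
    case 0
    then show ?case by (simp add: graph_ball_def)
  next
    case (Suc e)
    have e: "{p (s + e), p (s + Suc e)} \<in> edges G" using edge[of "s + e"] Suc.prems by simp
    have "p (s + Suc e) \<in> graph_ball G (p (s + e)) 1"
      using e vert Suc.prems by (intro graph_ball_edge) auto
    moreover have "p (s + e) \<in> graph_ball G (p (s + Suc e)) 1"
      using e vert Suc.prems by (intro graph_ball_edge) (auto simp: insert_commute)
    ultimately show ?case
      using graph_ball_trans Suc by (metis Suc_leD add.commute add_Suc_right plus_1_eq_Suc)
  qed
  show ?thesis
  proof (cases "s \<le> s'")
    case True
    then show ?thesis using up[of s "s' - s"] assms by simp
  next
    case False
    then show ?thesis using up[of s' "s - s'"] assms by simp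
  qed
qed

text \<open>The legs cover the vertices, but \<open>G\<close> may have further edges, which only enlarge the balls.\<close>

lemma burnable_within_of_spanning_spider:
  fixes a :: "'i \<Rightarrow> nat" and p :: "'i \<Rightarrow> nat \<Rightarrow> 'a"
  assumes "finite I" "I \<noteq> {}" "1 + sum a I \<le> k\<^sup>2"
    and head: "\<And>i. i \<in> I \<Longrightarrow> p i 0 = h"
    and vert: "\<And>i j. i \<in> I \<Longrightarrow> j \<le> a i \<Longrightarrow> p i j \<in> verts G"
    and edge: "\<And>i j. i \<in> I \<Longrightarrow> j < a i \<Longrightarrow> {p i j, p i (Suc j)} \<in> edges G"
    and span: "\<And>v. v \<in> verts G \<Longrightarrow> \<exists>i\<in>I. \<exists>j\<le>a i. v = p i j"
  shows "burnable_within G k"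
proof -
  obtain c where cover: "(\<forall>r<k. fst (c r) \<in> I \<and> snd (c r) \<le> a (fst (c r))) \<and>
      (\<forall>i\<in>I. \<forall>j\<le>a i. \<exists>r<k. spider_dist (c r) (i, j) \<le> r)"
    using spider_cover[OF assms(1-3)] by (rule exE)
  note c = cover[THEN conjunct1, rule_format] and cov = cover[THEN conjunct2, rule_format]
  have leg: "p i s' \<in> graph_ball G (p i s) ((s - s') + (s' - s))"
    if "i \<in> I" "s \<le> a i" "s' \<le> a i" for i s s'
    using that by (intro leg_point_in_graph_ball[where m = "a i" and p = "p i"] vert edge)
  have ball: "p i' s' \<in> graph_ball G (p i s) (spider_dist (i, s) (i', s'))"
    if "i \<in> I" "s \<le> a i" "i' \<in> I" "s' \<le> a i'" for i s i' s'
  proof (cases "i = i'")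
    case True
    then show ?thesis using leg that by simp
  next
    case False
    have "h \<in> graph_ball G (p i s) s" using leg[of i s 0] that head[of i] by simp
    moreover have "p i' s' \<in> graph_ball G h s'" using leg[of i' 0 s'] that head[of i'] by simp
    ultimately show ?thesis using graph_ball_trans False by simp
  qed
  show ?thesis
  proof (rule burnable_within_of_ball_cover[where c = "\<lambda>r. p (fst (c r)) (snd (c r))"])
    show "p (fst (c r)) (snd (c r)) \<in> verts G" if "r < k" for r
      using c[OF that] vert by blast
  next
    fix v assume "v \<in> verts G"
    then obtain i j where ij: "i \<in> I" "j \<le> a i" "v = p i j" using span by blast
    then obtain r where r: "r < k" "spider_dist (c r) (i, j) \<le> r" using cov by blast
    have "v \<in> graph_ball G (p (fst (c r)) (snd (c r))) (spider_dist (c r) (i, j))"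
      using ball[of "fst (c r)" "snd (c r)" i j] c[OF r(1)] ij by simp
    then have "v \<in> graph_ball G (p (fst (c r)) (snd (c r))) r"
      by (rule subsetD[OF graph_ball_radius_mono[OF r(2)]])
    with r(1) show "\<exists>r<k. v \<in> graph_ball G (p (fst (c r)) (snd (c r))) r"
      by (intro exI[of _ r] conjI)
  qed
qed

section \<open>The unicyclic graphs\<close>

lemma mem_verts_unicyclic [simp]:
  "Cyc c \<in> verts (unicyclic g as) \<longleftrightarrow> 1 \<le> c \<and> c \<le> g"
  "Pth i j \<in> verts (unicyclic g as) \<longleftrightarrow> i < length as \<and> 1 \<le> j \<and> j \<le> as ! i"
  by (auto simp: unicyclic_def)

lemma verts_unicyclic:
  "verts (unicyclic g as) = Cyc ` {1..g} \<union> case_prod Pth ` (SIGMA i:{..<length as}. {1..as ! i})"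
  by (auto simp: unicyclic_def image_iff)

lemma card_verts_unicyclic: "card (verts (unicyclic g as)) = g + sum_list as"
proof -
  have inj: "inj_on (case_prod Pth) X" "inj_on Cyc Y" for X Y by (auto simp: inj_on_def)
  have "card (verts (unicyclic g as)) = card (Cyc ` {1..g})
    + card (case_prod Pth ` (SIGMA i:{..<length as}. {1..as ! i}))"
    unfolding verts_unicyclic by (rule card_Un_disjoint) auto
  also have "\<dots> = g + (\<Sum>i<length as. as ! i)"
    by (simp add: card_image inj)
  finally show ?thesis by (simp add: sum_list_sum_nth atLeast0LessThan)
qed

lemma burnable_within_unicyclic:
  assumes "1 \<le> g" "g + sum_list as \<le> k\<^sup>2"
  shows "burnable_within (unicyclic g as) k"
proof -
  \<comment> \<open>Leg \<open>0\<close> is the cycle without its edge from \<open>Cyc (g - 1)\<close> to \<open>Cyc g\<close>, and leg \<open>i + 1\<close> is the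
    attached path number \<open>i\<close>.\<close>
  define a where "a i = (case i of 0 \<Rightarrow> g - 1 | Suc i \<Rightarrow> as ! i)" for i
  define p where "p i j = (if j = 0 then Cyc g else case i of 0 \<Rightarrow> Cyc j | Suc i \<Rightarrow> Pth i j)" for i j
  have "sum a {..<Suc (length as)} = (g - 1) + sum_list as"
    unfolding sum.lessThan_Suc_shift by (simp add: a_def sum_list_sum_nth atLeast0LessThan)
  then have "1 + sum a {..<Suc (length as)} \<le> k\<^sup>2" using assms by simp
  then show ?thesis
  proof (rule burnable_within_of_spanning_spider[where I = "{..<Suc (length as)}" and p = p and h = "Cyc g", rotated 2])
    show "p i j \<in> verts (unicyclic g as)" if "i \<in> {..<Suc (length as)}" "j \<le> a i" for i j
      using that assms(1) by (auto simp: p_def a_def split: nat.splits)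
  next
    fix i j assume ij: "i \<in> {..<Suc (length as)}" "j < a i"
    show "{p i j, p i (Suc j)} \<in> edges (unicyclic g as)"
    proof (cases i)
      case 0
      then show ?thesis using ij
        by (cases "j = 0") (auto simp: p_def a_def unicyclic_def)
    next
      case (Suc i')
      then show ?thesis using ij
        by (cases "j = 0") (auto simp: p_def a_def unicyclic_def)
    qed
  next
    fix v assume v: "v \<in> verts (unicyclic g as)"
    show "\<exists>i\<in>{..<Suc (length as)}. \<exists>j\<le>a i. v = p i j"
    proof (cases v)
      case (Cyc c)
      then show ?thesis using v
        by (intro bexI[of _ 0] exI[of _ "if c = g then 0 else c"]) (auto simp: p_def a_def)
    next
      case (Pth i j)
      then show ?thesis using v
        by (intro bexI[of _ "Suc i"] exI[of _ j]) (auto simp: p_def a_def)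
    qed
  qed (auto simp: p_def)
qed

section \<open>Balls in the unicyclic graphs\<close>

fun head_dist :: "nat \<Rightarrow> uvert \<Rightarrow> int" where
  "head_dist g (Cyc c) = min (int c) (int g - int c)"
| "head_dist g (Pth i j) = int j"

text \<open>The values are integers so that differences of distances and radii need no truncation.\<close>

fun unicyclic_dist :: "nat \<Rightarrow> uvert \<Rightarrow> uvert \<Rightarrow> int" where
  "unicyclic_dist g (Cyc c) (Cyc c') = min \<bar>int c - int c'\<bar> (int g - \<bar>int c - int c'\<bar>)"
| "unicyclic_dist g (Pth i j) (Pth i' j') = (if i = i' then \<bar>int j - int j'\<bar> else int j + int j')"
| "unicyclic_dist g x y = head_dist g x + head_dist g y"

lemma unicyclic_dist_edge:
  assumes "x \<in> verts (unicyclic g as)" "{u, v} \<in> edges (unicyclic g as)"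
  shows "unicyclic_dist g x v \<le> unicyclic_dist g x u + 1"
  using assms by (cases x) (auto simp: unicyclic_def doubleton_eq_iff)

text \<open>The straight line through a centre is the cycle, run round as \<open>s\<close> grows, for a centre on the
  cycle.  For a centre on an attached path it is that path, continued through \<open>v\<^sub>g\<close> along
  \<open>v\<^sub>1, v\<^sub>2, \<dots>\<close>.  In both cases exactly \<open>t\<close> branches at \<open>v\<^sub>g\<close> lie beside the line.  For a centre on
  the path number \<open>i0\<close>, the index \<open>i0\<close> of this path is free and denotes the other arm of the
  cycle, \<open>Cyc (g - 1), Cyc (g - 2), \<dots>\<close>.\<close>

fun straight :: "nat \<Rightarrow> uvert \<Rightarrow> int \<Rightarrow> uvert" where
  "straight g (Cyc c) s = (let z = int c + s in
     Cyc (nat (if z < 1 then z + int g else if z > int g then z - int g else z)))"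
| "straight g (Pth i j) s = (let z = int j + s in
     if z \<ge> 1 then Pth i (nat z) else if z = 0 then Cyc g else Cyc (nat (- z)))"

fun side_branch :: "nat \<Rightarrow> uvert \<Rightarrow> nat \<times> nat \<Rightarrow> uvert" where
  "side_branch g (Cyc c) (i, j) = Pth i j"
| "side_branch g (Pth i0 j0) (i, j) = (if i = i0 then Cyc (g - j) else Pth i j)"

lemma cycle_ball_straight:
  assumes "1 \<le> c" "c \<le> g" "1 \<le> c'" "c' \<le> g"
    and "unicyclic_dist g (Cyc c) (Cyc c') \<le> int r"
  shows "Cyc c' \<in> straight g (Cyc c) ` {- int r..int r}"
proof -
  consider "\<bar>int c - int c'\<bar> \<le> int r" | "c' > c" "int g - (int c' - int c) \<le> int r"
    | "c' \<le> c" "int g - (int c - int c') \<le> int r"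
    using assms(5) unfolding unicyclic_dist.simps by linarith
  then show ?thesis
  proof cases
    case 1
    then show ?thesis using assms by (intro image_eqI[of _ _ "int c' - int c"]) auto
  next
    case 2
    then show ?thesis using assms by (intro image_eqI[of _ _ "int c' - int c - int g"]) auto
  next
    case 3
    then show ?thesis using assms by (intro image_eqI[of _ _ "int c' - int c + int g"]) auto
  qed
qed

text \<open>A shortest route that leaves the line of its start passes through \<open>v\<^sub>g\<close>.\<close>

lemma ball_straight_or_near_head:
  assumes "x \<in> verts (unicyclic g as)" "y \<in> verts (unicyclic g as)"
    and "unicyclic_dist g x y \<le> int r"
  shows "y \<in> straight g x ` {- int r..int r} \<or> head_dist g y \<le> int r - head_dist g x"
proof (cases x)
  case x: (Cyc c)
  then show ?thesis using assms cycle_ball_straight by (cases y) auto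
next
  case x: (Pth i j)
  show ?thesis
  proof (cases y)
    case (Pth i' j')
    then show ?thesis using assms x
      by (cases "i = i'") (auto intro!: image_eqI[of _ _ "int j' - int j"])
  qed (use assms x in auto)
qed

text \<open>This describes, for a centre \<open>x\<close>, the whole neighbourhood of \<open>v\<^sub>g\<close> that its ball reaches.  It is
  applied to the ball with the largest such neighbourhood.\<close>

lemma near_head_straight_or_side_branch:
  assumes x: "x \<in> verts (unicyclic g as)" and y: "y \<in> verts (unicyclic g as)"
    and near: "head_dist g y \<le> int r - head_dist g x"
  shows "y \<in> straight g x ` {- int r..int r}
    \<union> side_branch g x ` ({..<length as} \<times> {1..nat (int r - head_dist g x)})"
proof (cases x)
  case xc: (Cyc c)
  show ?thesis
  proof (cases y)
    case (Cyc c')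
    then show ?thesis using xc x y near cycle_ball_straight[of c g c' r] by auto
  next
    case (Pth i j)
    then have "y = side_branch g x (i, j)"
      "(i, j) \<in> {..<length as} \<times> {1..nat (int r - head_dist g x)}"
      using xc y near by auto
    then show ?thesis by blast
  qed
next
  case xp: (Pth i j)
  show ?thesis
  proof (cases y)
    case yp: (Pth i' j')
    show ?thesis
    proof (cases "i = i'")
      case True
      then have "y \<in> straight g x ` {- int r..int r}"
        using xp yp x y near by (intro image_eqI[of _ _ "int j' - int j"]) auto
      then show ?thesis by blast
    next
      case False
      then have "y = side_branch g x (i', j')"
        "(i', j') \<in> {..<length as} \<times> {1..nat (int r - head_dist g x)}"
        using xp yp y near by auto
      then show ?thesis by blast
    qed
  next
    case yc: (Cyc c)
    consider "c = g" | "int c \<le> int r - int j" | "c < g" "int g - int c \<le> int r - int j"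
      using xp yc y near by (force simp: min_def split: if_splits)
    then show ?thesis
    proof cases
      case 1
      then have "y \<in> straight g x ` {- int r..int r}"
        using xp yc y near by (intro image_eqI[of _ _ "- int j"]) auto
      then show ?thesis by blast
    next
      case 2
      then have "y \<in> straight g x ` {- int r..int r}"
        using xp yc y by (intro image_eqI[of _ _ "- int j - int c"]) auto
      then show ?thesis by blast
    next
      case 3
      then have "y = side_branch g x (i, g - c)"
        "(i, g - c) \<in> {..<length as} \<times> {1..nat (int r - head_dist g x)}"
        using xp yc x y by auto
      then show ?thesis by blast
    qed
  qed
qed

lemma sum_odd_lessThan: "(\<Sum>r<k. 2 * r + 1) = (k\<^sup>2 :: nat)"
  by (induction k) (auto simp: power2_eq_square)

text \<open>All vertices lie on the straight parts of the balls, at most \<open>2 * r + 1\<close> for radius \<open>r\<close>, or on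
  the side branches of a single ball.\<close>

lemma order_le_of_burnable_within_unicyclic:
  assumes g: "1 \<le> g" and burn: "burnable_within (unicyclic g as) k"
  shows "g + sum_list as \<le> k\<^sup>2 + length as * (k - 1)"
proof -
  let ?V = "verts (unicyclic g as)" and ?t = "length as"
  have head: "Cyc g \<in> ?V" using g by simp
  have refl: "unicyclic_dist g x x = 0" if "x \<in> ?V" for x using that by (cases x) auto
  have lip: "unicyclic_dist g x v \<le> unicyclic_dist g x u + 1"
    if "x \<in> ?V" "u \<in> ?V" "v \<in> ?V" "{u, v} \<in> edges (unicyclic g as)" for x u v
    by (rule unicyclic_dist_edge[OF that(1,4)])
  obtain c where c: "(\<forall>r. c r \<in> ?V) \<and> (\<forall>v\<in>?V. \<exists>r<k. unicyclic_dist g (c r) v \<le> int r)"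
    using ball_cover_of_burnable_within[where d = "unicyclic_dist g", OF burn head refl lip]
    by (rule exE)
  note cV = c[THEN conjunct1, rule_format] and cov = c[THEN conjunct2, rule_format]
  have hd0: "0 \<le> head_dist g x" if "x \<in> ?V" for x using that by (cases x) auto
  define R where "R = {r. r < k \<and> head_dist g (c r) \<le> int r}"
  have "R \<noteq> {}"
  proof -
    obtain r where r: "r < k" "unicyclic_dist g (c r) (Cyc g) \<le> int r" using cov[OF head] by blast
    have "unicyclic_dist g x (Cyc g) = head_dist g x" if "x \<in> ?V" for x
      using that by (cases x) auto
    then show ?thesis using r cV by (auto simp: R_def)
  qed
  have finR: "finite R" by (simp add: R_def)
  \<comment> \<open>The ball that reaches farthest beyond \<open>v\<^sub>g\<close> absorbs the side branches of all others.\<close>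
  define h where "h r = int r - head_dist g (c r)" for r
  have "Max (h ` R) \<in> h ` R" using finR \<open>R \<noteq> {}\<close> by (intro Max_in) auto
  then obtain q where q: "q \<in> R" and hq: "h q = Max (h ` R)" by auto
  have qmax: "h r \<le> h q" if "r \<in> R" for r
    unfolding hq using finR that by (intro Max_ge) auto
  define \<rho> where "\<rho> = nat (int q - head_dist g (c q))"
  have \<rho>: "\<rho> \<le> k - 1" using q hd0[OF cV[of q]] by (auto simp: R_def \<rho>_def)
  define Q where "Q r = straight g (c r) ` {- int r..int r}" for r
  define E where "E = side_branch g (c q) ` ({..<?t} \<times> {1..\<rho>})"
  have "?V \<subseteq> E \<union> (\<Union>r<k. Q r)"
  proof
    fix y assume y: "y \<in> ?V"
    then obtain r where r: "r < k" "unicyclic_dist g (c r) y \<le> int r" using cov by blast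
    from ball_straight_or_near_head[OF cV y r(2)]
    show "y \<in> E \<union> (\<Union>r<k. Q r)"
    proof
      assume "y \<in> straight g (c r) ` {- int r..int r}"
      then show ?thesis using r(1) by (auto simp: Q_def)
    next
      assume near: "head_dist g y \<le> int r - head_dist g (c r)"
      then have "r \<in> R" using r(1) hd0[OF y] by (auto simp: R_def)
      then have "head_dist g y \<le> int q - head_dist g (c q)" using near qmax[of r] by (simp add: h_def)
      then have "y \<in> Q q \<union> E"
        using near_head_straight_or_side_branch[OF cV y] by (simp add: Q_def E_def \<rho>_def)
      then show ?thesis using q by (auto simp: R_def)
    qed
  qed
  then have "card ?V \<le> card (E \<union> (\<Union>r<k. Q r))"
    by (intro card_mono) (auto simp: E_def Q_def)
  also have "\<dots> \<le> card E + (\<Sum>r<k. card (Q r))"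
    by (intro order_trans[OF card_Un_le] add_left_mono card_UN_le) auto
  also have "card E \<le> ?t * (k - 1)"
  proof -
    have "card E \<le> card ({..<?t} \<times> {1..\<rho>})" unfolding E_def by (intro card_image_le) auto
    also have "\<dots> = ?t * \<rho>" by (simp add: card_cartesian_product)
    finally show ?thesis using \<rho> by (meson mult_le_mono2 order_trans)
  qed
  also have "(\<Sum>r<k. card (Q r)) \<le> (\<Sum>r<k. 2 * r + 1)"
  proof (rule sum_mono)
    fix r
    have "card (Q r) \<le> card {- int r..int r}" unfolding Q_def by (intro card_image_le) auto
    then show "card (Q r) \<le> 2 * r + 1" by simp
  qed
  finally show ?thesis by (simp only: card_verts_unicyclic sum_odd_lessThan) simp
qed

theorem theorem2p6:
  fixes n g t :: nat and G :: "'a ugraph"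
  assumes "3 \<le> g"
    and "1 \<le> t" and "int t \<le> int n - int g"
    and "G \<in> unicyclic_family n g t"
  shows "\<lceil>sqrt (real n + (real t ^ 2 + 4 * real t) / 4) - real t / 2\<rceil> \<le> int (burning_number G)
       \<and> int (burning_number G) \<le> \<lceil>sqrt (real n)\<rceil>"
proof -
  obtain as where t: "length as = t" and n: "n = g + sum_list as"
    and iso: "graph_iso G (unicyclic g as)"
    using assms(4) unfolding unicyclic_family_def by blast
  define b where "b = burning_number G"
  define k where "k = nat \<lceil>sqrt (real n)\<rceil>"
  have "- 1 < sqrt (real n)" by (rule less_le_trans[of _ 0]) simp_all
  then have k: "int k = \<lceil>sqrt (real n)\<rceil>" unfolding k_def by simp
  have "sqrt (real n) \<le> real k" unfolding k_def by (rule real_nat_ceiling_ge)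
  then have "real n \<le> real (k\<^sup>2)" using sqrt_le_D by fastforce
  then have "n \<le> k\<^sup>2" unfolding of_nat_le_iff .
  then have "burnable_within (unicyclic g as) k"
    using burnable_within_unicyclic[of g as k] assms(1) n by simp
  then have burn: "burnable_within G k"
    using burnable_within_iso graph_iso_sym[OF iso] by blast
  have upper: "b \<le> k" unfolding b_def burning_number_def using burn by (rule Least_le)
  have "burnable_within G b" unfolding b_def burning_number_def using burn by (rule LeastI)
  then have order: "n \<le> b\<^sup>2 + t * (b - 1)"
    using order_le_of_burnable_within_unicyclic[of g as b] burnable_within_iso[OF iso] assms(1) n t
    by simp
  have "b \<noteq> 0" using order n assms(1) by (cases b) auto
  then have "real n \<le> (real b)\<^sup>2 + real t * (real b - 1)"
    using order by (metis (mono_tags) One_nat_def Suc_leI bot_nat_0.not_eq_extremum of_nat_1 of_nat_add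
        of_nat_diff of_nat_le_iff of_nat_mult of_nat_power)
  then have "real n + (real t ^ 2 + 4 * real t) / 4 \<le> (real b + real t / 2)\<^sup>2"
    by (simp add: power2_eq_square field_simps)
  then have "sqrt (real n + (real t ^ 2 + 4 * real t) / 4) \<le> real b + real t / 2"
    by (intro real_le_lsqrt) auto
  then have "\<lceil>sqrt (real n + (real t ^ 2 + 4 * real t) / 4) - real t / 2\<rceil> \<le> int b"
    by (simp add: ceiling_le_iff)
  then show ?thesis using upper k unfolding b_def by linarith
qed

end
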